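(* Let $\mathbf{Z}\subset\mathbb{R}^N$ be a $(P^{-1}A)$-invariant subspace (i.e. $P^{-1}A\mathbf{Z}\subset\mathbf{Z}$), of dimension $M<N$, containing all generalized eigenvectors associated with the troublesome eigenvalues of $\mathrm{Id}-P^{-1}A$, and let $Q_R$ be any projection onto $\mathbf{Z}$ (a linear map with $Q_R^2=Q_R$ and image $\mathbf{Z}$). Then the spectrum (with multiplicity) of the matrix $\mathrm{Id}-(Q_R+P^{-1}A(\mathrm{Id}-Q_R))$ is $$\mathrm{Sp}\left(\mathrm{Id}-(Q_R+P^{-1}A(\mathrm{Id}-Q_R))\right)=(\underbrace{0,\dots,0}_{M},\lambda_{M+1},\dots,\lambda_N),$$ where $\lambda_{M+1},\dots,\lambda_N$ are the non-deflated eigenvalues of $\mathrm{Id}-P^{-1}A$. Consequently, the iterations $$x^{(n+1)}=x^{(n)}+\left(Q_R+P^{-1}A(\mathrm{Id}-Q_R)\right)(x^\infty-x^{(n)})$$ (which are the fixed-point iterations with the preconditioner $\underline{P}$) converge, at a rate determined by the largest non-deflated eigenvalue in modulus, i.e. the spectral radius of their error-propagation matrix $\mathrm{Id}-(Q_R+P^{-1}A(\mathrm{Id}-Q_R))$ is $\max_{M+1\le i\le N}|\lambda_i|<1$.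
   Context: $A\in GL_N(\mathbb{R})$ and $P\in GL_N(\mathbb{R})$ (the preconditioner) are given, $b\in\mathbb{R}^N$, and $x^\infty$ is the solution of $Ax^\infty=b$. The eigenvalues of $\mathrm{Id}-P^{-1}A$, counted with multiplicity, are denoted $\lambda_1,\dots,\lambda_N$ (complex in general). The deflated eigenvalues $\lambda_1,\dots,\lambda_M$ are the eigenvalues of the restriction of $\mathrm{Id}-P^{-1}A$ to $\mathbf{Z}$; the non-deflated ones $\lambda_{M+1},\dots,\lambda_N$ are the remaining ones (with multiplicity). The eigenvalues of modulus at least $1$ are among the troublesome (deflated) ones, that is, $|\lambda_i|<1$ for all $i\in\{M+1,\dots,N\}$. The preconditioner $\underline{P}$ is defined by $\underline{P}=\left(A^{-1}Q_L+P^{-1}(\mathrm{Id}-Q_L)\right)^{-1}$ with $Q_L=AQ_RA^{-1}$, so that $\underline{P}^{-1}A=Q_R+P^{-1}A(\mathrm{Id}-Q_R)$. *)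

theory Defs
  imports "Jordan_Normal_Form.Spectral_Radius" "Jordan_Normal_Form.VS_Connect"
    "Jordan_Normal_Form.Gauss_Jordan_Elimination"
begin

text \<open>Matrices in \<open>GL\<^sub>N(\<real>)\<close> and vectors of \<open>\<real>\<^sup>N\<close> are those in \<^term>\<open>carrier_mat N N\<close> and
  \<^term>\<open>carrier_vec N\<close>.\<close>

text \<open>The inverse; meaningful only for invertible matrices.\<close>

definition minv :: "real mat \<Rightarrow> real mat" where
  "minv A = the (mat_inverse A)"

abbreviation complex_mat :: "real mat \<Rightarrow> complex mat" where
  "complex_mat \<equiv> map_mat complex_of_real"

text \<open>The spectrum with (algebraic) multiplicity. The constant \<^const>\<open>spectrum\<close> only gives the
  underlying set.\<close>

definition eigvals :: "real mat \<Rightarrow> complex multiset" where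
  "eigvals T = proots (char_poly (complex_mat T))"

abbreviation vec_subspace :: "nat \<Rightarrow> real vec set \<Rightarrow> bool" where
  "vec_subspace N Z \<equiv> VectorSpace.subspace class_ring Z (module_vec TYPE(real) N)"

text \<open>A subspace, regarded as a vector space in its own right.\<close>

abbreviation subspace_vs :: "nat \<Rightarrow> real vec set \<Rightarrow> (real, real vec) module" where
  "subspace_vs N Z \<equiv> (module_vec TYPE(real) N)\<lparr>carrier := Z\<rparr>"

abbreviation vec_subspace_dim :: "nat \<Rightarrow> real vec set \<Rightarrow> nat" where
  "vec_subspace_dim N Z \<equiv> vectorspace.dim class_ring (subspace_vs N Z)"

text \<open>\<open>C\<close> is the matrix, in some ordered basis of the invariant subspace \<open>Z\<close> (the columns of
  \<open>B\<close>), of the restriction of \<open>T\<close> to \<open>Z\<close>. For \<open>Z = {0}\<close> the matrix \<open>B\<close> has no column, and \<open>C\<close> is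
  the \<open>0 \<times> 0\<close> matrix.\<close>

definition restriction_matrix :: "nat \<Rightarrow> real mat \<Rightarrow> real vec set \<Rightarrow> real mat \<Rightarrow> bool" where
  "restriction_matrix N T Z C \<longleftrightarrow>
     (\<exists>m B. B \<in> carrier_mat N m \<and> distinct (cols B) \<and>
        vectorspace.basis class_ring (subspace_vs N Z) (set (cols B)) \<and>
        C \<in> carrier_mat m m \<and> T * B = B * C)"

text \<open>The eigenvalues, with multiplicity, of the restriction; they do not depend on the basis,
  since changing the basis replaces \<open>C\<close> by a similar matrix.\<close>

definition restriction_eigvals :: "nat \<Rightarrow> real mat \<Rightarrow> real vec set \<Rightarrow> complex multiset" where
  "restriction_eigvals N T Z = (THE E. \<exists>C. restriction_matrix N T Z C \<and> E = eigvals C)"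

definition non_deflated_eigvals :: "nat \<Rightarrow> real mat \<Rightarrow> real vec set \<Rightarrow> complex multiset" where
  "non_deflated_eigvals N T Z = eigvals T - restriction_eigvals N T Z"

definition generalized_eigenvector :: "complex mat \<Rightarrow> complex vec \<Rightarrow> complex \<Rightarrow> bool" where
  "generalized_eigenvector T v e \<longleftrightarrow>
     v \<in> carrier_vec (dim_row T) \<and> v \<noteq> 0\<^sub>v (dim_row T) \<and>
     (\<exists>k. (char_matrix T e ^\<^sub>m k) *\<^sub>v v = 0\<^sub>v (dim_row T))"

text \<open>Generalized eigenvectors are complex in general, so a real subspace contains them in the
  sense that its complexification \<open>Z + \<i>Z\<close> does.\<close>

definition complexification :: "real vec set \<Rightarrow> complex vec set" where
  "complexification Z = {v. map_vec Re v \<in> Z \<and> map_vec Im v \<in> Z}"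

definition projection_onto :: "nat \<Rightarrow> real vec set \<Rightarrow> real mat \<Rightarrow> bool" where
  "projection_onto N Z Q \<longleftrightarrow>
     Q \<in> carrier_mat N N \<and> Q * Q = Q \<and> (\<lambda>v. Q *\<^sub>v v) ` carrier_vec N = Z"

definition deflated_matrix :: "nat \<Rightarrow> real mat \<Rightarrow> real mat \<Rightarrow> real mat \<Rightarrow> real mat" where
  "deflated_matrix N A P Q = Q + minv P * A * (1\<^sub>m N - Q)"

definition left_projection :: "real mat \<Rightarrow> real mat \<Rightarrow> real mat" where
  "left_projection A Q = A * Q * minv A"

text \<open>The deflated preconditioner is by definition the inverse of the following matrix.\<close>

definition deflated_precond_inverse :: "nat \<Rightarrow> real mat \<Rightarrow> real mat \<Rightarrow> real mat \<Rightarrow> real mat" where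
  "deflated_precond_inverse N A P Q =
     minv A * left_projection A Q + minv P * (1\<^sub>m N - left_projection A Q)"

definition deflated_precond :: "nat \<Rightarrow> real mat \<Rightarrow> real mat \<Rightarrow> real mat \<Rightarrow> real mat" where
  "deflated_precond N A P Q = minv (deflated_precond_inverse N A P Q)"

text \<open>The fixed-point iteration for \<open>A x = b\<close> with preconditioner \<open>R\<close>.\<close>

definition fixed_point_iteration ::
  "real mat \<Rightarrow> real mat \<Rightarrow> real vec \<Rightarrow> (nat \<Rightarrow> real vec) \<Rightarrow> bool" where
  "fixed_point_iteration A R b x \<longleftrightarrow>
     (\<forall>n. x (Suc n) = x n + minv R *\<^sub>v (b - A *\<^sub>v x n))"

definition euclidean_norm :: "real vec \<Rightarrow> real" where
  "euclidean_norm v = sqrt (v \<bullet> v)"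

definition vec_converges :: "(nat \<Rightarrow> real vec) \<Rightarrow> real vec \<Rightarrow> bool" where
  "vec_converges x l \<longleftrightarrow> (\<lambda>n. euclidean_norm (x n - l)) \<longlonglongrightarrow> 0"

end

theory Submission
  imports Defs
begin

text \<open>Write \<open>T = 1 - P\<^sup>-\<^sup>1 A\<close> and \<open>Q\<close> for the projection onto \<open>Z\<close>. Everything rests on the factorization
  \<open>1 - (Q + P\<^sup>-\<^sup>1 A (1 - Q)) = T (1 - Q)\<close> of the error matrix. In a basis adapted to \<open>Z\<close> the operator \<open>T\<close> is block
  upper triangular, its first diagonal block is the restriction to \<open>Z\<close>, and multiplication by \<open>1 - Q\<close>
  replaces that block by zero and keeps the second one. Hence the spectrum of \<open>T (1 - Q)\<close> consists of
  \<open>M\<close> zeros and the non-deflated eigenvalues.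

  The formal proof uses no adapted basis of the whole space. If the columns of \<open>B\<close> are a basis of \<open>Z\<close>, then
  \<open>Q = B L\<close> with \<open>L B = 1\<close>, and the restriction has the matrix \<open>L T B\<close>. Three facts about
  characteristic polynomials replace the block decomposition: \<open>U V\<close> and \<open>V U\<close> agree up to powers of
  \<open>X\<close> (\<open>char_poly_mult_swap\<close>), the polynomials of \<open>T (1 - Q)\<close> and \<open>T Q\<close> multiply to \<open>X\<^sup>N\<close> times that of \<open>T\<close>
  (\<open>char_poly_split_invariant_range\<close>), and \<open>X\<^sup>M\<close> divides the polynomial of \<open>T (1 - Q)\<close>
  (\<open>char_poly_mult_complementary_projection_dvd\<close>). They also show that the eigenvalues of the restriction
  do not depend on \<open>B\<close>.

  Suppose that a non-deflated eigenvalue \<open>e\<close> had modulus at least 1. Then the complexification of \<open>Z\<close>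
  contains all generalized eigenvectors for \<open>e\<close>, while an eigenvector of \<open>T (1 - Q)\<close> for \<open>e\<close> provides
  a vector outside it that \<open>T - e\<close> maps into it, which \<open>generalized_eigenspace_absorbs\<close> rules out. So the spectral radius
  of the error matrix is below 1. This gives convergence, and, since 1 is then not an eigenvalue of the error
  matrix, the invertibility of the deflated preconditioner.\<close>

section \<open>Characteristic polynomials and idempotents\<close>

declare minus_carrier_mat [simp, intro]

text \<open>Sylvester's determinant identity. The factors \<open>a ^ m\<close> and \<open>a ^ n\<close> keep it division-free, so that it
  can be used over a polynomial ring with \<open>a = X\<close>.\<close>

lemma det_scalar_minus_mult_swap:
  fixes a :: "'a :: idom"
  assumes U: "U \<in> carrier_mat n m" and V: "V \<in> carrier_mat m n"
  shows "a ^ m * det (a \<cdot>\<^sub>m 1\<^sub>m n - U * V) = a ^ n * det (a \<cdot>\<^sub>m 1\<^sub>m m - V * U)"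
proof -
  \<comment> \<open>Clearing either off-diagonal block of \<open>F\<close> computes its determinant in two ways.\<close>
  let ?F = "four_block_mat (a \<cdot>\<^sub>m 1\<^sub>m n) U V (1\<^sub>m m)"
  have F: "?F \<in> carrier_mat (n + m) (n + m)" by auto
  let ?G = "four_block_mat (1\<^sub>m n) (0\<^sub>m n m) (- V) (1\<^sub>m m)"
  let ?H = "four_block_mat (1\<^sub>m n) (0\<^sub>m n m) (- V) (a \<cdot>\<^sub>m 1\<^sub>m m)"
  have UV: "U * V \<in> carrier_mat n n" and VU: "V * U \<in> carrier_mat m m" using U V by auto
  have "?F * ?G = four_block_mat (a \<cdot>\<^sub>m 1\<^sub>m n - U * V) U (0\<^sub>m m n) (1\<^sub>m m)"
    by (subst mult_four_block_mat[of _ n n _ m _ m])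
      (use U V UV in \<open>auto intro!: cong_four_block_mat\<close>)
  then have "det ?F * det ?G = det (a \<cdot>\<^sub>m 1\<^sub>m n - U * V)"
    using det_mult[OF F, of ?G] U V UV
      det_four_block_mat_lower_left_zero[of "a \<cdot>\<^sub>m 1\<^sub>m n - U * V" n U m "0\<^sub>m m n" "1\<^sub>m m"]
    by auto
  moreover have "det ?G = 1"
    using det_four_block_mat_upper_right_zero[of "1\<^sub>m n" n "0\<^sub>m n m" m "- V" "1\<^sub>m m"] V by auto
  moreover have "?H * ?F = four_block_mat (a \<cdot>\<^sub>m 1\<^sub>m n) U (0\<^sub>m m n) (a \<cdot>\<^sub>m 1\<^sub>m m - V * U)"
    by (subst mult_four_block_mat[of _ n n _ m _ m])
      (use U V VU in \<open>auto intro!: cong_four_block_mat eq_matI\<close>)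
  then have "det ?H * det ?F = a ^ n * det (a \<cdot>\<^sub>m 1\<^sub>m m - V * U)"
    using det_mult[OF _ F, of ?H] U V VU
      det_four_block_mat_lower_left_zero[of "a \<cdot>\<^sub>m 1\<^sub>m n" n U m "0\<^sub>m m n" "a \<cdot>\<^sub>m 1\<^sub>m m - V * U"]
    by auto
  moreover have "det ?H = a ^ m"
    using det_four_block_mat_upper_right_zero[of "1\<^sub>m n" n "0\<^sub>m n m" m "- V" "a \<cdot>\<^sub>m 1\<^sub>m m"] V by auto
  ultimately show ?thesis by simp
qed

text \<open>Lifting \<open>A\<close> to constant polynomials turns the characteristic polynomial into the determinant of the
  matrix expression \<open>X - A\<close>, to which matrix algebra over the polynomial ring applies.\<close>

definition const_mat :: "'a :: zero mat \<Rightarrow> 'a poly mat" where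
  "const_mat A = map_mat (\<lambda>a. [:a:]) A"

lemma const_mat_carrier [simp]: "const_mat A \<in> carrier_mat n m \<longleftrightarrow> A \<in> carrier_mat n m"
  by (auto simp: const_mat_def)

interpretation const_poly: comm_ring_hom "\<lambda>a :: 'a :: comm_ring_1. [:a:]"
  by unfold_locales (auto simp: one_pCons)

lemma const_mat_mult:
  fixes A :: "'a :: comm_ring_1 mat"
  assumes "A \<in> carrier_mat n m" "B \<in> carrier_mat m k"
  shows "const_mat (A * B) = const_mat A * const_mat B"
  unfolding const_mat_def by (rule const_poly.mat_hom_mult[OF assms])

lemma const_mat_one [simp]: "const_mat (1\<^sub>m n :: 'a :: comm_ring_1 mat) = 1\<^sub>m n"
  unfolding const_mat_def by (rule const_poly.mat_hom_one)

lemma const_mat_minus: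
  fixes A :: "'a :: comm_ring_1 mat"
  assumes "A \<in> carrier_mat n m" "B \<in> carrier_mat n m"
  shows "const_mat (A - B) = const_mat A - const_mat B"
  unfolding const_mat_def using assms by (intro eq_matI) auto

lemma char_poly_const_mat:
  fixes A :: "'a :: comm_ring_1 mat"
  assumes "A \<in> carrier_mat n n"
  shows "char_poly A = det ([:0, 1:] \<cdot>\<^sub>m 1\<^sub>m n - const_mat A)"
proof -
  have "char_poly_matrix A = [:0, 1:] \<cdot>\<^sub>m 1\<^sub>m n - const_mat A"
    unfolding char_poly_matrix_def const_mat_def using assms by (intro eq_matI) auto
  then show ?thesis by (simp add: char_poly_def)
qed

lemma char_poly_mult_swap:
  fixes U V :: "'a :: idom mat"
  assumes U: "U \<in> carrier_mat n m" and V: "V \<in> carrier_mat m n"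
  shows "[:0, 1:] ^ m * char_poly (U * V) = [:0, 1:] ^ n * char_poly (V * U)"
proof -
  have UV: "U * V \<in> carrier_mat n n" and VU: "V * U \<in> carrier_mat m m" using U V by auto
  show ?thesis
    using det_scalar_minus_mult_swap[of "const_mat U" n m "const_mat V" "[:0, 1:]"] U V
    by (simp add: char_poly_const_mat[OF UV] char_poly_const_mat[OF VU]
        const_mat_mult[OF U V] const_mat_mult[OF V U])
qed

text \<open>The hypothesis says that \<open>T\<close> maps the range of \<open>Q\<close> into the set of vectors fixed by \<open>Q\<close>. Then
  the product \<open>T (1 - Q) T Q\<close> vanishes, so the two summands of \<open>T\<close> have characteristic polynomials
  that multiply as for a block triangular matrix. The surplus power of \<open>X\<close> accounts for the kernels of
  the two summands.\<close>

lemma char_poly_split_invariant_range: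
  fixes T Q :: "'a :: idom mat"
  assumes T: "T \<in> carrier_mat n n" and Q: "Q \<in> carrier_mat n n"
    and inv: "Q * (T * Q) = T * Q"
  shows "char_poly (T * (1\<^sub>m n - Q)) * char_poly (T * Q) = [:0, 1:] ^ n * char_poly T"
proof -
  let ?x = "[:0, 1:] :: 'a poly"
  let ?I = "?x \<cdot>\<^sub>m 1\<^sub>m n"
  define E where "E = const_mat (T * (1\<^sub>m n - Q))"
  define F where "F = const_mat (T * Q)"
  have TQ: "T * Q \<in> carrier_mat n n" and TR: "T * (1\<^sub>m n - Q) \<in> carrier_mat n n"
    using T Q by auto
  have E: "E \<in> carrier_mat n n" and F: "F \<in> carrier_mat n n"
    using T Q by (auto simp: E_def F_def)
  have "(1\<^sub>m n - Q) * (T * Q) = 0\<^sub>m n n"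
    using minus_mult_distrib_mat[of "1\<^sub>m n" n n Q "T * Q" n] Q TQ inv
      minus_r_inv_mat[OF TQ] left_mult_one_mat[OF TQ] by simp
  then have "T * (1\<^sub>m n - Q) * (T * Q) = 0\<^sub>m n n"
    using T Q TQ assoc_mult_mat[OF T _ TQ, of "1\<^sub>m n - Q"] by auto
  then have EF: "E * F = 0\<^sub>m n n"
    unfolding E_def F_def using T Q TQ
    by (subst const_mat_mult[symmetric, of _ n n _ n]) (auto simp: const_mat_def)
  have "T * (1\<^sub>m n - Q) + T * Q = T"
    using mult_minus_distrib_mat[of T n n "1\<^sub>m n" n Q] T Q TQ
    by (auto intro!: eq_matI)
  then have sum: "E $$ (i, j) + F $$ (i, j) = const_mat T $$ (i, j)" if "i < n" "j < n" for i j
    using that T Q TQ unfolding E_def F_def const_mat_def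
    by (metis (no_types, lifting) add_pCons add_0 carrier_matD index_add_mat(1)
        index_map_mat(1) index_mult_mat(2,3) index_minus_mat(3))
  \<comment> \<open>Over the polynomial ring \<open>(X - E) (X - F) = X (X - E - F)\<close>, because \<open>E F = 0\<close>.\<close>
  have "(?I - E) * (?I - F) = ?I * (?I - F) - E * (?I - F)"
    by (rule minus_mult_distrib_mat) (use E F in auto)
  also have "E * (?I - F) = ?x \<cdot>\<^sub>m E"
    using mult_minus_distrib_mat[of E n n ?I n F] mult_smult_distrib[of E n n "1\<^sub>m n" n ?x] E F EF
    by (auto intro!: eq_matI)
  also have "?I * (?I - F) = ?x \<cdot>\<^sub>m (?I - F)"
    using mult_smult_assoc_mat[of "1\<^sub>m n" n n "?I - F" n ?x] F by simp
  also have "?x \<cdot>\<^sub>m (?I - F) - ?x \<cdot>\<^sub>m E = ?x \<cdot>\<^sub>m (?I - const_mat T)"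
    using E F T sum by (intro eq_matI) (auto simp: algebra_simps const_mat_def)
  finally have "det (?I - E) * det (?I - F) = ?x ^ n * det (?I - const_mat T)"
    using det_mult[of "?I - E" n "?I - F"] E F T by simp
  then show ?thesis
    using char_poly_const_mat[OF TR] char_poly_const_mat[OF TQ] char_poly_const_mat[OF T]
    unfolding E_def F_def by simp
qed

text \<open>\<open>B L\<close> is an idempotent of rank \<open>m\<close>, and \<open>T (1 - B L)\<close> vanishes on its range, so 0 is an eigenvalue
  of multiplicity at least \<open>m\<close>.\<close>

lemma char_poly_mult_complementary_projection_dvd:
  fixes T B L :: "'a :: idom mat"
  assumes T: "T \<in> carrier_mat n n" and B: "B \<in> carrier_mat n m" and L: "L \<in> carrier_mat m n"
    and LB: "L * B = 1\<^sub>m m"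
  shows "[:0, 1:] ^ m dvd char_poly (T * (1\<^sub>m n - B * L))"
proof -
  let ?x = "[:0, 1:] :: 'a poly"
  let ?I = "?x \<cdot>\<^sub>m 1\<^sub>m n"
  define b l where "b = const_mat B" and "l = const_mat L"
  have b: "b \<in> carrier_mat n m" and l: "l \<in> carrier_mat m n"
    using B L by (auto simp: b_def l_def)
  have lb: "l * b = 1\<^sub>m m"
    using LB B L const_mat_mult[of L m n B m] by (simp add: b_def l_def)
  define q where "q = b * l"
  have q: "q \<in> carrier_mat n n" using b l by (auto simp: q_def)
  have qq: "q * q = q"
    using b l lb assoc_mult_mat[of b n m l n "b * l" n] assoc_mult_mat[of l m n b m l n]
    by (simp add: q_def)
  define E where "E = const_mat (T * (1\<^sub>m n - B * L))"
  define t where "t = const_mat T"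
  have t: "t \<in> carrier_mat n n" using T by (auto simp: t_def)
  have E: "E \<in> carrier_mat n n" using T B L by (auto simp: E_def)
  have E_alt: "E = t * (1\<^sub>m n - q)"
  proof -
    have "1\<^sub>m n - B * L \<in> carrier_mat n n" "B * L \<in> carrier_mat n n" using B L by auto
    then show ?thesis
      using T const_mat_mult[OF T, of "1\<^sub>m n - B * L" n] const_mat_mult[OF B L]
        const_mat_minus[of "1\<^sub>m n" n n "B * L"]
      by (simp add: E_def t_def q_def b_def l_def)
  qed
  have "(1\<^sub>m n - q) * q = 0\<^sub>m n n"
    using minus_mult_distrib_mat[of "1\<^sub>m n" n n q q n] q qq by simp
  then have Eq: "E * q = 0\<^sub>m n n"
    using t q assoc_mult_mat[OF t _ q, of "1\<^sub>m n - q"] by (auto simp: E_alt)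
  \<comment> \<open>With \<open>q = B L\<close>, the second factor \<open>S = 1 + (X - 1) q\<close> acts as \<open>X\<close> on the range of \<open>q\<close> and as
    the identity on its kernel; \<open>E q = 0\<close> makes the factorization \<open>X - E = S' S\<close> possible.\<close>
  define S where "S = 1\<^sub>m n - (1 - ?x) \<cdot>\<^sub>m q"
  define S' where "S' = ?I - E - (?x - 1) \<cdot>\<^sub>m q"
  have S: "S \<in> carrier_mat n n" and S': "S' \<in> carrier_mat n n" using q E by (auto simp: S_def S'_def)
  have "S' * S = S' * 1\<^sub>m n - S' * ((1 - ?x) \<cdot>\<^sub>m q)"
    unfolding S_def by (rule mult_minus_distrib_mat) (use S' q in auto)
  also have "S' * ((1 - ?x) \<cdot>\<^sub>m q) = (1 - ?x) \<cdot>\<^sub>m (S' * q)"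
    by (rule mult_smult_distrib) (use S' q in auto)
  also have "S' * q = ?I * q - E * q - (?x - 1) \<cdot>\<^sub>m (q * q)"
    unfolding S'_def
    using minus_mult_distrib_mat[of "?I - E" n n "(?x - 1) \<cdot>\<^sub>m q" q n]
      minus_mult_distrib_mat[of ?I n n E q n] mult_smult_assoc_mat[of q n n q n "?x - 1"] q E
    by simp
  also have "\<dots> = q"
    using mult_smult_assoc_mat[of "1\<^sub>m n" n n q n ?x] q
    by (auto simp: Eq qq algebra_simps intro!: eq_matI)
  finally have "S' * S = ?I - E"
    using S' q E unfolding S'_def by (auto simp: algebra_simps intro!: eq_matI)
  then have "char_poly (T * (1\<^sub>m n - B * L)) = det S' * det S"
    using det_mult[OF S' S] char_poly_const_mat[of "T * (1\<^sub>m n - B * L)" n] T B L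
    by (simp add: E_def)
  moreover have "det S = ?x ^ m"
  proof -
    have one: "1 \<cdot>\<^sub>m 1\<^sub>m k = (1\<^sub>m k :: 'a poly mat)" for k by (auto intro!: eq_matI)
    have "det (1\<^sub>m n - ((1 - ?x) \<cdot>\<^sub>m b) * l) = det (1\<^sub>m m - l * ((1 - ?x) \<cdot>\<^sub>m b))"
      using det_scalar_minus_mult_swap[of "(1 - ?x) \<cdot>\<^sub>m b" n m l 1] b l by (simp add: one)
    also have "((1 - ?x) \<cdot>\<^sub>m b) * l = (1 - ?x) \<cdot>\<^sub>m q"
      unfolding q_def by (rule mult_smult_assoc_mat) (use b l in auto)
    also have "1\<^sub>m m - l * ((1 - ?x) \<cdot>\<^sub>m b) = ?x \<cdot>\<^sub>m 1\<^sub>m m"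
      using mult_smult_distrib[of l m n b m "1 - ?x"] b l lb
      by (auto simp: algebra_simps intro!: eq_matI)
    finally show ?thesis by (simp add: S_def)
  qed
  ultimately show ?thesis by simp
qed

text \<open>In a basis of the whole space adapted to the range of \<open>B\<close>, \<open>T\<close> is block upper triangular with first
  diagonal block \<open>L T B\<close>, and \<open>T (1 - B L)\<close> has zero as its first block and the same second block. The
  polynomial \<open>g\<close> is the characteristic polynomial of this common second block.\<close>

lemma char_poly_deflated:
  fixes T Q B L :: "'a :: idom mat"
  assumes T: "T \<in> carrier_mat n n" and B: "B \<in> carrier_mat n m" and L: "L \<in> carrier_mat m n"
    and LB: "L * B = 1\<^sub>m m" and inv: "B * L * (T * (B * L)) = T * (B * L)"
  obtains g where "char_poly (T * (1\<^sub>m n - B * L)) = [:0, 1:] ^ m * g"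
    "char_poly T = g * char_poly (L * (T * B))"
proof -
  let ?x = "[:0, 1:] :: 'a poly"
  obtain g where g: "char_poly (T * (1\<^sub>m n - B * L)) = ?x ^ m * g"
    using char_poly_mult_complementary_projection_dvd[OF T B L LB] by blast
  have BL: "B * L \<in> carrier_mat n n" and TB: "T * B \<in> carrier_mat n m" using T B L by auto
  \<comment> \<open>Up to powers of \<open>X\<close>, \<open>T B L\<close> and \<open>L T B\<close> have the same characteristic polynomial, and the powers
    cancel.\<close>
  have "?x ^ n * (g * char_poly (L * (T * B))) = g * (?x ^ m * char_poly (T * B * L))"
    using char_poly_mult_swap[OF TB L] by (simp add: algebra_simps)
  also have "\<dots> = char_poly (T * (1\<^sub>m n - B * L)) * char_poly (T * (B * L))"
    using g assoc_mult_mat[OF T B L] by (simp add: algebra_simps)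
  also have "\<dots> = ?x ^ n * char_poly T"
    by (rule char_poly_split_invariant_range[OF T BL inv])
  finally have "char_poly T = g * char_poly (L * (T * B))" by simp
  with g show ?thesis by (rule that)
qed

lemma char_poly_nonzero:
  fixes T :: "'a :: idom mat"
  assumes "T \<in> carrier_mat n n" shows "char_poly T \<noteq> 0"
  using degree_monic_char_poly[OF assms] by auto

section \<open>Basis matrices and projections\<close>

lemma mat_unit_vec_col:
  fixes A :: "'a :: semiring_1 mat"
  assumes "A \<in> carrier_mat n m" "i < m"
  shows "A *\<^sub>v unit_vec m i = col A i"
  using assms by (intro eq_vecI) auto

lemma subspace_basis_mat_injective:
  assumes Z: "vec_subspace N Z"
    and B: "B \<in> carrier_mat N m" "distinct (cols B)"
    and basis: "vectorspace.basis class_ring (subspace_vs N Z) (set (cols B))"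
    and v: "v \<in> carrier_vec m" "B *\<^sub>v v = 0\<^sub>v N"
  shows "v = 0\<^sub>v m"
proof -
  interpret V: vec_space "TYPE(real)" N .
  interpret W: vectorspace class_ring "subspace_vs N Z" by (rule V.subspace_is_vs[OF Z])
  have sub: "submodule class_ring Z (module_vec TYPE(real) N)"
    using Z by (simp add: VectorSpace.subspace_def)
  have cols_Z: "set (cols B) \<subseteq> Z" using basis by (auto simp: W.basis_def)
  have indpt: "V.lin_indpt (set (cols B))"
    using basis V.span_li_not_depend(2)[OF cols_Z sub] by (simp add: W.basis_def)
  have len: "length (cols B) = m" using B by simp
  \<comment> \<open>The coefficient function is a sum over indices; it returns the entries of \<open>v\<close> because the columns
    are distinct.\<close>
  define f where "f l = (\<Sum>i = 0..<length (cols B). if l = cols B ! i then v $ i else 0)" for l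
  have "B *\<^sub>v v = V.lincomb f (set (cols B))"
    using V.mat_of_cols_mult_as_finsum[of v "cols B"] v B len mat_of_cols_cols[of B]
      cols_dim[of B] unfolding f_def by (auto simp: subset_iff)
  then have zero: "f w = 0" if "w \<in> set (cols B)" for w
    using indpt v that unfolding V.lin_dep_def by (metis List.finite_set subset_refl)
  show ?thesis
  proof (rule eq_vecI)
    fix i assume "i < dim_vec (0\<^sub>v m :: real vec)"
    then have i: "i < length (cols B)" using len by simp
    have "f (cols B ! i) = (\<Sum>j = 0..<length (cols B). if i = j then v $ j else 0)"
      unfolding f_def by (rule sum.cong)
        (use i B(2) in \<open>auto simp: nth_eq_iff_index_eq simp del: cols_nth cols_length\<close>)
    also have "\<dots> = v $ i" using i by simp
    finally show "v $ i = 0\<^sub>v m $ i" using zero[of "cols B ! i"] i len nth_mem[OF i] by simp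
  qed (use v in simp)
qed

lemma subspace_basis_mat_range:
  assumes Z: "vec_subspace N Z"
    and B: "B \<in> carrier_mat N m"
    and basis: "vectorspace.basis class_ring (subspace_vs N Z) (set (cols B))"
  shows "Z = (\<lambda>v. B *\<^sub>v v) ` carrier_vec m"
proof -
  interpret V: vec_space "TYPE(real)" N .
  interpret W: vectorspace class_ring "subspace_vs N Z" by (rule V.subspace_is_vs[OF Z])
  have sub: "submodule class_ring Z (module_vec TYPE(real) N)"
    using Z by (simp add: VectorSpace.subspace_def)
  have cols_Z: "set (cols B) \<subseteq> Z" using basis by (auto simp: W.basis_def)
  have "V.col_space B = Z"
    using basis V.span_li_not_depend(1)[OF cols_Z sub] by (simp add: W.basis_def V.col_space_def)
  then show ?thesis
    using V.col_space_eq[OF B] B by auto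
qed

lemma subspace_basis_mat_dim:
  assumes Z: "vec_subspace N Z"
    and B: "B \<in> carrier_mat N m" "distinct (cols B)"
    and basis: "vectorspace.basis class_ring (subspace_vs N Z) (set (cols B))"
  shows "vec_subspace_dim N Z = m"
proof -
  interpret V: vec_space "TYPE(real)" N .
  interpret W: vectorspace class_ring "subspace_vs N Z" by (rule V.subspace_is_vs[OF Z])
  show ?thesis using W.dim_basis[OF _ basis] B by (simp add: distinct_card)
qed

lemma projection_onto_fixes:
  assumes "projection_onto N Z Q" "z \<in> Z"
  shows "Q *\<^sub>v z = z"
  using assms unfolding projection_onto_def by (auto simp flip: assoc_mult_mat_vec)

text \<open>Invariance of \<open>Z\<close> as a matrix identity, which survives complexification.\<close>

lemma projection_onto_invariant_mat:
  assumes Q: "projection_onto N Z Q" and T: "T \<in> carrier_mat N N"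
    and inv: "\<And>z. z \<in> Z \<Longrightarrow> T *\<^sub>v z \<in> Z"
  shows "Q * (T * Q) = T * Q"
proof (rule mat_col_eqI)
  have QN: "Q \<in> carrier_mat N N" using Q by (simp add: projection_onto_def)
  fix i assume "i < dim_col (T * Q)"
  then have i: "i < N" using QN by simp
  have "col Q i = Q *\<^sub>v unit_vec N i" using mat_unit_vec_col[OF QN i] by simp
  then have "col Q i \<in> Z" using Q by (auto simp: projection_onto_def)
  then have "Q *\<^sub>v (T *\<^sub>v col Q i) = T *\<^sub>v col Q i"
    using projection_onto_fixes[OF Q] inv by blast
  then show "col (Q * (T * Q)) i = col (T * Q) i"
    using col_mult2[OF T QN i] col_mult2[OF QN mult_carrier_mat[OF T QN] i] by metis
qed (use T Q in \<open>auto simp: projection_onto_def\<close>)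

text \<open>A basis is finite because \<open>Z\<close> is the column space of the projection.\<close>

lemma projection_onto_basis_exists:
  assumes Z: "vec_subspace N Z" and Q: "projection_onto N Z Q"
  obtains m B where "B \<in> carrier_mat N m" "distinct (cols B)"
    "vectorspace.basis class_ring (subspace_vs N Z) (set (cols B))"
proof -
  interpret V: vec_space "TYPE(real)" N .
  interpret W: vectorspace class_ring "subspace_vs N Z" by (rule V.subspace_is_vs[OF Z])
  have QN: "Q \<in> carrier_mat N N" using Q by (simp add: projection_onto_def)
  have "Z = V.span (set (cols Q))"
    using V.col_space_eq[OF QN] Q QN by (auto simp: V.col_space_def projection_onto_def)
  then have "W.fin_dim" using V.fin_dim_span_cols[OF QN] by simp
  then obtain \<beta> where \<beta>: "finite \<beta>" "W.basis \<beta>" using W.finite_basis_exists by blast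
  then obtain bs where bs: "set bs = \<beta>" "distinct bs" using finite_distinct_list by blast
  have "\<beta> \<subseteq> carrier_vec N"
    using \<beta>(2) Z by (auto simp: W.basis_def VectorSpace.subspace_def submodule_def module_vec_simps)
  then have "cols (mat_of_cols N bs) = bs" using bs by simp
  with bs \<beta> that[of "mat_of_cols N bs" "length bs"] show ?thesis by simp
qed

text \<open>In the coordinates given by a basis matrix \<open>B\<close> of \<open>Z\<close>, a projection onto \<open>Z\<close> is a left inverse \<open>L\<close> of
  \<open>B\<close>. With such an \<open>L\<close> the restriction of an operator \<open>T\<close> to \<open>Z\<close> has the matrix \<open>L T B\<close>, and a basis of a
  complement of \<open>Z\<close> need not be chosen.\<close>

lemma projection_onto_factorization:
  assumes Z: "vec_subspace N Z" and Q: "projection_onto N Z Q"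
    and B: "B \<in> carrier_mat N m" "distinct (cols B)"
    and basis: "vectorspace.basis class_ring (subspace_vs N Z) (set (cols B))"
  obtains L where "L \<in> carrier_mat m N" "Q = B * L" "L * B = 1\<^sub>m m"
proof -
  have QN: "Q \<in> carrier_mat N N" using Q by (simp add: projection_onto_def)
  note range = subspace_basis_mat_range[OF Z B(1) basis]
  have "\<exists>c \<in> carrier_vec m. col Q i = B *\<^sub>v c" if "i < N" for i
  proof -
    have "Q *\<^sub>v unit_vec N i \<in> Z" using Q by (auto simp: projection_onto_def)
    moreover have "Q *\<^sub>v unit_vec N i = col Q i" using QN that by (rule mat_unit_vec_col)
    ultimately show ?thesis using range by auto
  qed
  then obtain c where c: "\<And>i. i < N \<Longrightarrow> c i \<in> carrier_vec m \<and> col Q i = B *\<^sub>v c i" by metis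
  define L where "L = mat_of_cols m (map c [0..<N])"
  have L: "L \<in> carrier_mat m N" unfolding L_def using mat_of_cols_carrier(1)[of m "map c [0..<N]"] by simp
  have QBL: "Q = B * L"
  proof (rule mat_col_eqI)
    fix i assume "i < dim_col (B * L)"
    then have i: "i < N" using L by simp
    have "col L i = c i" using c[OF i] i by (simp add: L_def)
    then show "col Q i = col (B * L) i" using c[OF i] col_mult2[OF B(1) L i] by metis
  qed (use QN B L in auto)
  \<comment> \<open>\<open>Q\<close> fixes the columns of \<open>B\<close>, so \<open>B L B = B\<close>, and \<open>B\<close> can be cancelled.\<close>
  have LB: "L * B = 1\<^sub>m m"
  proof (rule mat_col_eqI)
    fix i assume "i < dim_col (1\<^sub>m m :: real mat)"
    then have i: "i < m" by simp
    define v where "v = L *\<^sub>v (B *\<^sub>v unit_vec m i) - unit_vec m i"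
    have Bu: "B *\<^sub>v unit_vec m i \<in> carrier_vec N" using B by simp
    have v: "v \<in> carrier_vec m" using L B by (simp add: v_def)
    have "B *\<^sub>v unit_vec m i \<in> Z" using range by auto
    then have "B *\<^sub>v (L *\<^sub>v (B *\<^sub>v unit_vec m i)) = B *\<^sub>v unit_vec m i"
      using projection_onto_fixes[OF Q] QBL assoc_mult_mat_vec[OF B(1) L Bu] by simp
    then have "B *\<^sub>v v = 0\<^sub>v N"
      using B L Bu unfolding v_def by (subst mult_minus_distrib_mat_vec[of B N m]) auto
    then have "v = 0\<^sub>v m" by (rule subspace_basis_mat_injective[OF Z B basis v])
    then have "L *\<^sub>v (B *\<^sub>v unit_vec m i) = unit_vec m i"
    proof (intro eq_vecI)
      fix k assume "k < dim_vec (unit_vec m i :: real vec)"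
      with \<open>v = 0\<^sub>v m\<close> have k: "k < m" and "v $ k = 0" by simp_all
      then show "(L *\<^sub>v (B *\<^sub>v unit_vec m i)) $ k = unit_vec m i $ k"
        using L by (simp add: v_def)
    qed (use L in simp)
    then show "col (L * B) i = col (1\<^sub>m m) i"
      using col_mult2[OF L B(1) i] mat_unit_vec_col[OF B(1) i] col_one[OF i] by metis
  qed (use L B in auto)
  from L QBL LB show ?thesis by (rule that)
qed

text \<open>The complexification of \<open>Z\<close> consists of vectors fixed by the complexified projection, so a statement
  about this matrix replaces statements about real and imaginary parts.\<close>

lemma complexification_fixed_by_projection:
  assumes Q: "projection_onto N Z Q" and v: "v \<in> carrier_vec N" "v \<in> complexification Z"
  shows "complex_mat Q *\<^sub>v v = v"
proof (rule eq_vecI)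
  have QN: "Q \<in> carrier_mat N N" using Q by (simp add: projection_onto_def)
  then show "dim_vec (complex_mat Q *\<^sub>v v) = dim_vec v" using v by simp
  fix i assume "i < dim_vec v"
  then have i: "i < N" using v by simp
  have "Q *\<^sub>v map_vec Re v = map_vec Re v" "Q *\<^sub>v map_vec Im v = map_vec Im v"
    using v projection_onto_fixes[OF Q] by (auto simp: complexification_def)
  then have "(Q *\<^sub>v map_vec Re v) $ i = Re (v $ i)" "(Q *\<^sub>v map_vec Im v) $ i = Im (v $ i)"
    using i v by simp_all
  then have "(\<Sum>j = 0..<N. Q $$ (i, j) * Re (v $ j)) = Re (v $ i)"
    "(\<Sum>j = 0..<N. Q $$ (i, j) * Im (v $ j)) = Im (v $ i)"
    using i v QN by (simp_all add: scalar_prod_def)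
  then show "(complex_mat Q *\<^sub>v v) $ i = v $ i"
    using i v QN by (simp add: scalar_prod_def complex_eq_iff)
qed

section \<open>The spectrum of the deflated operator\<close>

lemma eigvals_conv_char_poly:
  assumes "T \<in> carrier_mat n n"
  shows "eigvals T = proots (map_poly complex_of_real (char_poly T))"
  unfolding eigvals_def using of_real_hom.char_poly_hom[OF assms] by metis

lemma set_mset_eigvals:
  assumes "T \<in> carrier_mat n n"
  shows "set_mset (eigvals T) = spectrum (complex_mat T)"
proof -
  have Tc: "complex_mat T \<in> carrier_mat n n" using assms by simp
  show ?thesis
    using char_poly_nonzero[OF Tc] spectrum_root_char_poly[OF Tc] by (simp add: eigvals_def)
qed

lemma size_eigvals:
  assumes "T \<in> carrier_mat n n"
  shows "size (eigvals T) = n"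
proof -
  have Tc: "complex_mat T \<in> carrier_mat n n" using assms by simp
  show ?thesis
    using degree_monic_char_poly[OF Tc] by (simp add: eigvals_def size_proots_complex)
qed

text \<open>Deflation replaces the eigenvalues of the restriction by zeros and keeps all the others: both multisets
  consist of the roots of the common cofactor \<open>g\<close> and of the part that comes from \<open>Z\<close>.\<close>

lemma eigvals_deflated:
  assumes Z: "vec_subspace N Z" and Q: "projection_onto N Z Q"
    and T: "T \<in> carrier_mat N N" and inv: "\<And>z. z \<in> Z \<Longrightarrow> T *\<^sub>v z \<in> Z"
  shows "eigvals (T * (1\<^sub>m N - Q)) =
    replicate_mset (vec_subspace_dim N Z) 0 + non_deflated_eigvals N T Z"
proof -
  let ?x = "[:0, 1:] :: real poly"
  let ?c = "map_poly complex_of_real"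
  interpret c: map_poly_comm_ring_hom complex_of_real ..
  have QN: "Q \<in> carrier_mat N N" using Q by (simp add: projection_onto_def)
  have QTQ: "Q * (T * Q) = T * Q" by (rule projection_onto_invariant_mat[OF Q T inv])
  have restr: "\<exists>g. char_poly (T * (1\<^sub>m N - Q)) = ?x ^ vec_subspace_dim N Z * g
      \<and> char_poly T = g * char_poly C" if "restriction_matrix N T Z C" for C
  proof -
    from that obtain m B where B: "B \<in> carrier_mat N m" "distinct (cols B)"
      and basis: "vectorspace.basis class_ring (subspace_vs N Z) (set (cols B))"
      and C: "C \<in> carrier_mat m m" "T * B = B * C"
      unfolding restriction_matrix_def by blast
    obtain L where L: "L \<in> carrier_mat m N" "Q = B * L" "L * B = 1\<^sub>m m"
      by (rule projection_onto_factorization[OF Z Q B basis])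
    have "C = L * (T * B)"
      using L C B assoc_mult_mat[OF L(1) B(1) C(1)] by simp
    with char_poly_deflated[OF T B(1) L(1,3)] QTQ L(2) subspace_basis_mat_dim[OF Z B basis]
    show ?thesis by metis
  qed
  have ex: "\<exists>C. restriction_matrix N T Z C"
  proof -
    obtain m B where B: "B \<in> carrier_mat N m" "distinct (cols B)"
      and basis: "vectorspace.basis class_ring (subspace_vs N Z) (set (cols B))"
      by (rule projection_onto_basis_exists[OF Z Q])
    obtain L where L: "L \<in> carrier_mat m N" "Q = B * L" "L * B = 1\<^sub>m m"
      by (rule projection_onto_factorization[OF Z Q B basis])
    have "Q * B = B" using assoc_mult_mat[OF B(1) L(1) B(1)] L B by simp
    then have "T * B = T * Q * B" using assoc_mult_mat[OF T QN B(1)] by simp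
    also have "\<dots> = Q * (T * Q) * B" by (simp add: QTQ)
    also have "\<dots> = Q * (T * B)"
      using assoc_mult_mat[OF QN mult_carrier_mat[OF T QN] B(1)] assoc_mult_mat[OF T QN B(1)]
        \<open>Q * B = B\<close> by simp
    also have "\<dots> = B * (L * (T * B))"
      using assoc_mult_mat[OF B(1) L(1) mult_carrier_mat[OF T B(1)]] L by simp
    finally have "T * B = B * (L * (T * B))" .
    moreover have "L * (T * B) \<in> carrier_mat m m" using L T B by auto
    ultimately show ?thesis using B basis unfolding restriction_matrix_def by blast
  qed
  have carrier: "C \<in> carrier_mat (dim_row C) (dim_row C)" if "restriction_matrix N T Z C" for C
    using that unfolding restriction_matrix_def by auto
  from ex obtain C where C: "restriction_matrix N T Z C" by blast
  obtain g where g: "char_poly (T * (1\<^sub>m N - Q)) = ?x ^ vec_subspace_dim N Z * g"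
      "char_poly T = g * char_poly C" using restr[OF C] by blast
  have "char_poly T \<noteq> 0" using T by (rule char_poly_nonzero)
  then have g0: "g \<noteq> 0" and C0: "char_poly C \<noteq> 0" using g by auto
  \<comment> \<open>The cofactor \<open>g\<close> is read off from \<open>T (1 - Q)\<close>, hence it is the same for all bases of \<open>Z\<close>; this makes
    the multiset that defines the restricted eigenvalues unique.\<close>
  have unique: "char_poly D = char_poly C" if "restriction_matrix N T Z D" for D
    using restr[OF that] g g0 by auto
  have "restriction_eigvals N T Z = eigvals C"
    unfolding restriction_eigvals_def
    using C unique carrier eigvals_conv_char_poly by (intro the_equality) metis+
  moreover have "eigvals T = proots (?c g) + eigvals C"
    using g0 C0 eigvals_conv_char_poly[OF T] eigvals_conv_char_poly[OF carrier[OF C]]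
    by (simp add: g c.hom_mult proots_mult)
  ultimately have nd: "non_deflated_eigvals N T Z = proots (?c g)"
    by (simp add: non_deflated_eigvals_def)
  have TR: "T * (1\<^sub>m N - Q) \<in> carrier_mat N N" using T QN by simp
  have "?c (?x ^ k) = [:0, 1:] ^ k" for k
    by (induction k) (simp_all add: c.hom_mult map_poly_pCons)
  then have "?c (char_poly (T * (1\<^sub>m N - Q))) = [:0, 1:] ^ vec_subspace_dim N Z * ?c g"
    by (simp add: g c.hom_mult)
  then have "eigvals (T * (1\<^sub>m N - Q)) = proots ([:0, 1:] ^ vec_subspace_dim N Z * ?c g)"
    by (simp add: eigvals_conv_char_poly[OF TR])
  also have "\<dots> = replicate_mset (vec_subspace_dim N Z) 0 + proots (?c g)"
  proof -
    have "proots ([:0, 1:] ^ k :: complex poly) = replicate_mset k 0" for k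
    proof (induction k)
      case (Suc k)
      then show ?case
        using proots_mult[of "[:0, 1:] :: complex poly" "[:0, 1:] ^ k"]
          proots_linear_factor[of "0 :: complex"] by simp
    qed simp
    then show ?thesis using g0 by (subst proots_mult) auto
  qed
  finally show ?thesis by (simp add: nd)
qed

section \<open>Generalized eigenspaces inside an invariant subspace\<close>

lemma char_matrix_mult_vec:
  assumes "T \<in> carrier_mat n n" "v \<in> carrier_vec n"
  shows "char_matrix T e *\<^sub>v v = T *\<^sub>v v - e \<cdot>\<^sub>v v"
proof -
  have "char_matrix T e *\<^sub>v v = T *\<^sub>v v + ((- e) \<cdot>\<^sub>m 1\<^sub>m n) *\<^sub>v v"
    using assms by (simp add: char_matrix_def add_mult_distrib_mat_vec[of T n n])
  also have "((- e) \<cdot>\<^sub>m 1\<^sub>m n) *\<^sub>v v = (- e) \<cdot>\<^sub>v v"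
    using assms by (auto intro!: eq_vecI)
  finally show ?thesis using assms by (auto intro!: eq_vecI)
qed

text \<open>A complete flag on whose successive quotients \<open>T\<close> acts by the scalars \<open>d j\<close>, with all occurrences
  of the eigenvalue \<open>e\<close> at the bottom.\<close>

lemma triangularizing_basis:
  fixes T :: "complex mat" and e :: complex
  assumes T: "T \<in> carrier_mat n n"
  obtains V d k where
    "V 0 = {0\<^sub>v n}" "V n = carrier_vec n" "\<And>j. V j \<subseteq> carrier_vec n" "k \<le> n"
    "\<And>j w. j < n \<Longrightarrow> w \<in> V (Suc j) \<Longrightarrow> T *\<^sub>v w - d j \<cdot>\<^sub>v w \<in> V j"
    "\<And>j. j < k \<Longrightarrow> d j = e" "\<And>j. k \<le> j \<Longrightarrow> j < n \<Longrightarrow> d j \<noteq> e"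
proof -
  obtain es where es: "char_poly T = (\<Prod>a\<leftarrow>es. [:- a, 1:])" "length es = n"
    using char_poly_factorized[OF T] by blast
  \<comment> \<open>A Schur decomposition exists for every ordering of the eigenvalues; the copies of \<open>e\<close> come first.\<close>
  define es' where "es' = filter (\<lambda>a. a = e) es @ filter (\<lambda>a. a \<noteq> e) es"
  define k where "k = length (filter (\<lambda>a. a = e) es)"
  have mset: "mset es' = mset es" by (simp add: es'_def)
  have "(\<Prod>a\<leftarrow>es'. [:- a, 1:]) = (\<Prod>a\<leftarrow>es. [:- a, 1:])"
    by (simp add: mset flip: prod_mset_prod_list)
  then have es': "char_poly T = (\<Prod>a\<leftarrow>es'. [:- a, 1:])" using es by simp
  have len: "length es' = n" using mset es(2) mset_eq_length by metis
  obtain U P P' where schur: "schur_decomposition T es' = (U, P, P')"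
    by (cases "schur_decomposition T es'") auto
  have sim: "similar_mat_wit T U P P'" and up: "upper_triangular U" and diag: "diag_mat U = es'"
    using schur_decomposition[OF T es' schur] by auto
  note wit = similar_mat_witD2[OF T sim]
  have U: "U \<in> carrier_mat n n" and P: "P \<in> carrier_mat n n" and P': "P' \<in> carrier_mat n n"
    using wit by auto
  \<comment> \<open>\<open>P'\<close> gives coordinates in the triangularizing basis, and \<open>V j\<close> is spanned by its first \<open>j\<close> vectors.\<close>
  define V where "V j = {w \<in> carrier_vec n. \<forall>i. j \<le> i \<longrightarrow> i < n \<longrightarrow> (P' *\<^sub>v w) $ i = 0}" for j
  define d where "d j = es' ! j" for j
  have d_diag: "d j = U $$ (j, j)" if "j < n" for j
    using that diag U by (auto simp: d_def diag_mat_def)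
  show ?thesis
  proof (rule that[of V k d])
    show "V 0 = {0\<^sub>v n}"
    proof
      show "V 0 \<subseteq> {0\<^sub>v n}"
      proof
        fix w assume w: "w \<in> V 0"
        then have wc: "w \<in> carrier_vec n" and "P' *\<^sub>v w = 0\<^sub>v n"
          using P' by (auto simp: V_def intro!: eq_vecI)
        then have "P *\<^sub>v (P' *\<^sub>v w) = 0\<^sub>v n" using P by auto
        then have "w = 0\<^sub>v n" using wc P P' wit(1) by (simp flip: assoc_mult_mat_vec)
        then show "w \<in> {0\<^sub>v n}" by simp
      qed
      show "{0\<^sub>v n} \<subseteq> V 0" using P' by (auto simp: V_def)
    qed
    show "V n = carrier_vec n" "\<And>j. V j \<subseteq> carrier_vec n" by (auto simp: V_def)
    show "k \<le> n" using es(2) by (auto simp: k_def)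
    show "d j = e" if "j < k" for j
      using that nth_mem[of j "filter (\<lambda>a. a = e) es"] by (auto simp: d_def es'_def k_def nth_append)
    show "d j \<noteq> e" if "k \<le> j" "j < n" for j
    proof -
      have "j - k < length (filter (\<lambda>a. a \<noteq> e) es)"
        using that len by (simp add: es'_def k_def)
      from nth_mem[OF this] show ?thesis
        using that by (auto simp: d_def es'_def k_def nth_append)
    qed
    show "T *\<^sub>v w - d j \<cdot>\<^sub>v w \<in> V j" if j: "j < n" and w: "w \<in> V (Suc j)" for j w
    proof -
      have wc: "w \<in> carrier_vec n" using w by (simp add: V_def)
      define y where "y = P' *\<^sub>v w"
      have y: "y \<in> carrier_vec n" and y0: "\<And>i. j < i \<Longrightarrow> i < n \<Longrightarrow> y $ i = 0"
        using w P' by (auto simp: V_def y_def)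
      have Uy: "U *\<^sub>v y \<in> carrier_vec n" using U y by simp
      have "T *\<^sub>v w = (P * U) *\<^sub>v y"
        unfolding y_def using assoc_mult_mat_vec[OF mult_carrier_mat[OF P U] P' wc] wit(3) by metis
      also have "\<dots> = P *\<^sub>v (U *\<^sub>v y)" by (rule assoc_mult_mat_vec[OF P U y])
      finally have PT: "P' *\<^sub>v (T *\<^sub>v w) = U *\<^sub>v y"
        using assoc_mult_mat_vec[OF P' P Uy] wit(2) Uy by simp
      have P'_diff: "P' *\<^sub>v (T *\<^sub>v w - d j \<cdot>\<^sub>v w) = U *\<^sub>v y - d j \<cdot>\<^sub>v y"
        using PT P' wc T unfolding y_def
        by (simp add: mult_minus_distrib_mat_vec[of _ n n] mult_mat_vec[of _ n n])
      have "(U *\<^sub>v y - d j \<cdot>\<^sub>v y) $ i = 0" if i: "j \<le> i" "i < n" for i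
      proof -
        \<comment> \<open>Only \<open>l = j\<close> contributes: \<open>U\<close> vanishes for \<open>l < j \<le> i\<close> and \<open>y\<close> vanishes for \<open>l > j\<close>.\<close>
        have "(U *\<^sub>v y) $ i = (\<Sum>l = 0..<n. U $$ (i, l) * y $ l)"
          using i U y by (simp add: scalar_prod_def)
        also have "\<dots> = (\<Sum>l = 0..<n. if l = j then U $$ (i, j) * y $ j else 0)"
        proof (rule sum.cong)
          fix l assume l: "l \<in> {0..<n}"
          consider "l < j" | "l = j" | "j < l" by linarith
          then show "U $$ (i, l) * y $ l = (if l = j then U $$ (i, j) * y $ j else 0)"
            using upper_triangularD[OF up, of l i] i l U y0[of l] by cases auto
        qed simp
        also have "\<dots> = U $$ (i, j) * y $ j" using j by simp
        also have "\<dots> = d j * y $ i"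
          using upper_triangularD[OF up, of j i] i U y0[of i] d_diag[OF j] by (cases "i = j") auto
        finally show ?thesis using i y U by simp
      qed
      then show ?thesis using P'_diff wc T by (simp add: V_def)
    qed
  qed
qed

text \<open>Suppose that the range of \<open>Q\<close> is invariant and contains the generalized eigenspace of \<open>e\<close>. Then \<open>e\<close> is not
  an eigenvalue of the operator that \<open>T\<close> induces on the quotient by this range: a vector that \<open>T - e\<close> sends
  into the range is already in it. The proof climbs a triangularizing flag. Its bottom part is
  annihilated by a power of \<open>T - e\<close>; above it, \<open>T - d j\<close> acts on the class of the vector as the nonzero
  scalar \<open>e - d j\<close> and moves the vector down the flag.\<close>

lemma generalized_eigenspace_absorbs:
  fixes T Q :: "complex mat"
  assumes T: "T \<in> carrier_mat n n" and Q: "Q \<in> carrier_mat n n"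
    and inv: "Q * (T * Q) = T * Q"
    and gen: "\<And>v k. v \<in> carrier_vec n \<Longrightarrow> (char_matrix T e ^\<^sub>m k) *\<^sub>v v = 0\<^sub>v n \<Longrightarrow> Q *\<^sub>v v = v"
    and w: "w \<in> carrier_vec n" "Q *\<^sub>v (T *\<^sub>v w - e \<cdot>\<^sub>v w) = T *\<^sub>v w - e \<cdot>\<^sub>v w"
  shows "Q *\<^sub>v w = w"
proof (rule triangularizing_basis[OF T, of e])
  fix V :: "nat \<Rightarrow> complex vec set" and d k
  assume V: "V 0 = {0\<^sub>v n}" "V n = carrier_vec n" "\<And>j. V j \<subseteq> carrier_vec n"
    and k: "k \<le> n"
    and step: "\<And>j w. j < n \<Longrightarrow> w \<in> V (Suc j) \<Longrightarrow> T *\<^sub>v w - d j \<cdot>\<^sub>v w \<in> V j"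
    and d: "\<And>j. j < k \<Longrightarrow> d j = e" "\<And>j. k \<le> j \<Longrightarrow> j < n \<Longrightarrow> d j \<noteq> e"
  have E: "char_matrix T e \<in> carrier_mat n n" using T by simp
  \<comment> \<open>On \<open>V k\<close> all diagonal entries equal \<open>e\<close>, so \<open>T - e\<close> is nilpotent there.\<close>
  have nil: "j \<le> k \<Longrightarrow> w \<in> V j \<Longrightarrow> (char_matrix T e ^\<^sub>m j) *\<^sub>v w = 0\<^sub>v n" for j w
  proof (induction j arbitrary: w)
    case 0
    then have "w = 0\<^sub>v n" using V(1) by simp
    then show ?case using carrier_matD[OF E] by simp
  next
    case (Suc j)
    have wc: "w \<in> carrier_vec n" using Suc.prems V(3) by blast
    have "T *\<^sub>v w - e \<cdot>\<^sub>v w \<in> V j" using step[of j w] Suc.prems d(1)[of j] k by simp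
    then have "(char_matrix T e ^\<^sub>m j) *\<^sub>v (char_matrix T e *\<^sub>v w) = 0\<^sub>v n"
      using Suc char_matrix_mult_vec[OF T wc] by simp
    then show ?case
      using assoc_mult_mat_vec[OF pow_carrier_mat[OF E, of j] E wc] by simp
  qed
  have "j \<le> n \<Longrightarrow> w \<in> V j \<Longrightarrow>
      Q *\<^sub>v (T *\<^sub>v w - e \<cdot>\<^sub>v w) = T *\<^sub>v w - e \<cdot>\<^sub>v w \<Longrightarrow> Q *\<^sub>v w = w"
    for j w
  proof (induction j arbitrary: w)
    case 0
    then have "w = 0\<^sub>v n" using V(1) by simp
    then show ?case using Q by (auto intro!: eq_vecI)
  next
    case (Suc j)
    have wc: "w \<in> carrier_vec n" using Suc.prems V(3) by blast
    show ?case
    proof (cases "Suc j \<le> k")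
      case True
      then show ?thesis using gen[OF wc nil] Suc.prems by blast
    next
      case False
      \<comment> \<open>Modulo the range of \<open>Q\<close> the vector \<open>w' = (T - d j) w\<close> equals \<open>(e - d j) w\<close> with \<open>e \<noteq> d j\<close>, and it lies
        one step lower in the flag.\<close>
      define z where "z = T *\<^sub>v w - e \<cdot>\<^sub>v w"
      define w' where "w' = T *\<^sub>v w - d j \<cdot>\<^sub>v w"
      have Tw: "T *\<^sub>v w \<in> carrier_vec n" using T wc by simp
      have zc: "z \<in> carrier_vec n" and wc': "w' \<in> carrier_vec n" using T wc by (auto simp: z_def w'_def)
      have Qz: "Q *\<^sub>v z = z" using Suc.prems by (simp add: z_def)
      have Tz: "Q *\<^sub>v (T *\<^sub>v z) = T *\<^sub>v z"
        using assoc_mult_mat_vec[OF Q mult_carrier_mat[OF T Q] zc] assoc_mult_mat_vec[OF T Q zc] inv Qz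
        by simp
      have Twz: "T *\<^sub>v w = z + e \<cdot>\<^sub>v w"
        using wc Tw carrier_matD[OF T] by (auto simp: z_def intro!: eq_vecI)
      have w'z: "w' = z + (e - d j) \<cdot>\<^sub>v w"
        using wc Tw carrier_matD[OF T] by (auto simp: z_def w'_def algebra_simps intro!: eq_vecI)
      have "T *\<^sub>v w' - e \<cdot>\<^sub>v w' = T *\<^sub>v z - d j \<cdot>\<^sub>v z"
        unfolding w'z using T wc zc Twz
        by (auto simp: mult_add_distrib_mat_vec[of _ n n] mult_mat_vec[of _ n n] algebra_simps intro!: eq_vecI)
      moreover have "Q *\<^sub>v (T *\<^sub>v z - d j \<cdot>\<^sub>v z) = T *\<^sub>v z - d j \<cdot>\<^sub>v z"
        using Q T zc Tz Qz by (simp add: mult_minus_distrib_mat_vec[of _ n n] mult_mat_vec[of _ n n])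
      moreover have "w' \<in> V j" unfolding w'_def using step[of j w] Suc.prems by simp
      ultimately have "Q *\<^sub>v w' = w'" using Suc.IH[of w'] Suc.prems by simp
      then have "z + (e - d j) \<cdot>\<^sub>v (Q *\<^sub>v w) = z + (e - d j) \<cdot>\<^sub>v w"
        unfolding w'z using Q wc zc Qz
        by (simp add: mult_add_distrib_mat_vec[of _ n n] mult_mat_vec[of _ n n])
      then have eq: "(z + (e - d j) \<cdot>\<^sub>v (Q *\<^sub>v w)) $ i = (z + (e - d j) \<cdot>\<^sub>v w) $ i" for i
        by simp
      have "(e - d j) * (Q *\<^sub>v w) $ i = (e - d j) * w $ i" if "i < n" for i
        using that eq[of i] carrier_matD[OF Q] wc zc by simp
      moreover have "e - d j \<noteq> 0" using d(2)[of j] False Suc.prems by simp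
      ultimately show ?thesis using Q wc by (intro eq_vecI) auto
    qed
  qed
  from this[of n w] show ?thesis using w V(2) by simp
qed

text \<open>The key point of the deflation: once \<open>Z\<close> contains the generalized eigenvectors for \<open>e\<close>, all copies of
  \<open>e\<close> belong to the restriction to \<open>Z\<close>. The value \<open>e = 0\<close> is excluded because the proof
  looks for \<open>e\<close> in the spectrum of the deflated matrix, where deflation has added zeros.\<close>

lemma non_deflated_eigval_not_absorbed:
  assumes Z: "vec_subspace N Z" and Q: "projection_onto N Z Q"
    and T: "T \<in> carrier_mat N N" and inv: "\<And>z. z \<in> Z \<Longrightarrow> T *\<^sub>v z \<in> Z"
    and e: "e \<noteq> 0"
    and gen: "\<And>v. generalized_eigenvector (complex_mat T) v e \<Longrightarrow> v \<in> complexification Z"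
  shows "e \<notin># non_deflated_eigvals N T Z"
proof
  assume "e \<in># non_deflated_eigvals N T Z"
  then have e_mem: "e \<in># eigvals (T * (1\<^sub>m N - Q))"
    using eigvals_deflated[OF Z Q T inv] by simp
  have QN: "Q \<in> carrier_mat N N" using Q by (simp add: projection_onto_def)
  have QQ: "Q * Q = Q" using Q by (simp add: projection_onto_def)
  define t q where "t = complex_mat T" and "q = complex_mat Q"
  have t: "t \<in> carrier_mat N N" and q: "q \<in> carrier_mat N N" using T QN by (auto simp: t_def q_def)
  have qq: "q * q = q" using of_real_hom.mat_hom_mult[OF QN QN] QQ unfolding q_def by metis
  have "complex_mat Q * (complex_mat T * complex_mat Q) = complex_mat T * complex_mat Q"
    using projection_onto_invariant_mat[OF Q T inv] T QN
      of_real_hom.mat_hom_mult[OF QN mult_carrier_mat[OF T QN]] of_real_hom.mat_hom_mult[OF T QN]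
    by metis
  then have qtq: "q * (t * q) = t * q" by (simp add: t_def q_def)
  have "complex_mat (1\<^sub>m N - Q) = 1\<^sub>m N - q" using QN by (auto simp: q_def intro!: eq_matI)
  then have "complex_mat (T * (1\<^sub>m N - Q)) = t * (1\<^sub>m N - q)"
    using of_real_hom.mat_hom_mult[OF T, of "1\<^sub>m N - Q" N] QN unfolding t_def
    by (metis minus_carrier_mat)
  then have "e \<in> spectrum (t * (1\<^sub>m N - q))"
    using e_mem set_mset_eigvals[of "T * (1\<^sub>m N - Q)" N] T QN by auto
  then obtain v where v: "v \<in> carrier_vec N" "v \<noteq> 0\<^sub>v N" and ev: "(t * (1\<^sub>m N - q)) *\<^sub>v v = e \<cdot>\<^sub>v v"
    using t unfolding spectrum_def eigenvalue_def eigenvector_def by auto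
  have qv: "q *\<^sub>v v \<in> carrier_vec N" using q v by simp
  \<comment> \<open>\<open>w\<close> is the component of the eigenvector \<open>v\<close> along the kernel of \<open>q\<close>. Modulo the range of \<open>q\<close> it is an
    eigenvector of \<open>t\<close> for the eigenvalue \<open>e\<close>, so it must lie in that range.\<close>
  define w where "w = v - q *\<^sub>v v"
  have w: "w \<in> carrier_vec N" using v qv by (simp add: w_def)
  have "(1\<^sub>m N - q) *\<^sub>v v = w"
    using v q by (simp add: w_def minus_mult_distrib_mat_vec[of _ N N])
  then have tw: "t *\<^sub>v w = e \<cdot>\<^sub>v v"
    using ev assoc_mult_mat_vec[OF t _ v(1), of "1\<^sub>m N - q"] q by simp
  have qqv: "q *\<^sub>v (q *\<^sub>v v) = q *\<^sub>v v" using assoc_mult_mat_vec[OF q q v(1)] qq by simp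
  have "t *\<^sub>v w - e \<cdot>\<^sub>v w = e \<cdot>\<^sub>v (q *\<^sub>v v)"
    unfolding tw using v carrier_matD[OF q] by (auto simp: w_def algebra_simps intro!: eq_vecI)
  then have "q *\<^sub>v (t *\<^sub>v w - e \<cdot>\<^sub>v w) = t *\<^sub>v w - e \<cdot>\<^sub>v w"
    using qqv qv q by (simp add: mult_mat_vec[of _ N N])
  moreover have "q *\<^sub>v u = u" if u: "u \<in> carrier_vec N" "(char_matrix t e ^\<^sub>m k) *\<^sub>v u = 0\<^sub>v N" for u k
  proof (cases "u = 0\<^sub>v N")
    case True
    then show ?thesis using q by (auto intro!: eq_vecI)
  next
    case False
    then have "generalized_eigenvector t u e"
      using u t unfolding generalized_eigenvector_def by auto
    then show ?thesis
      using gen complexification_fixed_by_projection[OF Q u(1)] by (simp add: t_def q_def)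
  qed
  ultimately have "q *\<^sub>v w = w"
    using generalized_eigenspace_absorbs[OF t q qtq _ w] by blast
  moreover have "q *\<^sub>v w = 0\<^sub>v N"
    unfolding w_def using mult_minus_distrib_mat_vec[OF q v(1) qv] qqv qv by simp
  moreover have "t *\<^sub>v 0\<^sub>v N = 0\<^sub>v N" using t by (intro eq_vecI) auto
  ultimately have "e \<cdot>\<^sub>v v = 0\<^sub>v N" using tw by simp
  then have "e * v $ i = 0" if "i < N" for i
    using that v by (metis carrier_vecD index_smult_vec(1) index_zero_vec(1))
  then have "v = 0\<^sub>v N" using e v by (intro eq_vecI) auto
  with v show False by simp
qed

section \<open>Convergence of linear iterations\<close>

lemma pow_mat_smult:
  fixes A :: "'a :: comm_ring_1 mat"
  assumes A: "A \<in> carrier_mat n n"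
  shows "(c \<cdot>\<^sub>m A) ^\<^sub>m k = c ^ k \<cdot>\<^sub>m (A ^\<^sub>m k)"
proof (induction k)
  case 0
  then show ?case using A by (auto intro!: eq_matI)
next
  case (Suc k)
  have Ak: "A ^\<^sub>m k \<in> carrier_mat n n" using A by (rule pow_carrier_mat)
  show ?case
    using Suc mult_smult_assoc_mat[OF Ak smult_carrier_mat[OF A]] mult_smult_distrib[OF Ak A] A Ak
    by (auto simp: ac_simps intro!: eq_matI)
qed

lemma smult_mat_mult_vec:
  fixes A :: "'a :: comm_ring_1 mat"
  assumes "A \<in> carrier_mat n m" "v \<in> carrier_vec m"
  shows "(c \<cdot>\<^sub>m A) *\<^sub>v v = c \<cdot>\<^sub>v (A *\<^sub>v v)"
  using assms by (auto intro!: eq_vecI)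

lemma spectral_radius_nonneg:
  assumes "A \<in> carrier_mat n n" "n > 0"
  shows "spectral_radius A \<ge> 0"
  using spectral_radius_mem_max(1)[OF assms] by auto

text \<open>Since the eigenvalues of \<open>A / r\<close> are those of \<open>A\<close> divided by \<open>r\<close>, the powers of \<open>A\<close> are
  \<open>O(r ^ k)\<close> for each \<open>r\<close> above the spectral radius.\<close>

lemma pow_mat_entries_tendsto_0:
  assumes A: "A \<in> carrier_mat n n" and sr: "spectral_radius A < 1"
    and ij: "i < n" "j < n"
  shows "(\<lambda>k. (A ^\<^sub>m k) $$ (i, j)) \<longlonglongrightarrow> 0"
proof -
  have n: "n > 0" using ij by simp
  \<comment> \<open>Rescaling by a radius strictly between \<open>spectral_radius A\<close> and 1 leaves a matrix with bounded powers.\<close>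
  define r where "r = (1 + spectral_radius A) / 2"
  have r: "0 < r" "r < 1" "spectral_radius A < r"
    using sr spectral_radius_nonneg[OF A n] by (auto simp: r_def)
  define A' where "A' = complex_of_real (1 / r) \<cdot>\<^sub>m A"
  have A': "A' \<in> carrier_mat n n" using A by (simp add: A'_def)
  have A_eq: "A = complex_of_real r \<cdot>\<^sub>m A'" using r A by (auto simp: A'_def intro!: eq_matI)
  obtain e where e: "e \<in> spectrum A'" "spectral_radius A' = cmod e"
    using spectral_radius_mem_max(1)[OF A' n] by auto
  obtain v where v: "v \<in> carrier_vec n" "v \<noteq> 0\<^sub>v n" "A' *\<^sub>v v = e \<cdot>\<^sub>v v"
    using e(1) A' by (auto simp: spectrum_def eigenvalue_def eigenvector_def)
  have "A *\<^sub>v v = (complex_of_real r * e) \<cdot>\<^sub>v v"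
    unfolding A_eq using A' v by (simp add: smult_mat_mult_vec smult_smult_assoc)
  then have "complex_of_real r * e \<in> spectrum A"
    using v A unfolding spectrum_def eigenvalue_def eigenvector_def by auto
  then have "cmod (complex_of_real r * e) \<le> spectral_radius A"
    by (intro spectral_radius_mem_max(2)[OF A n]) auto
  then have "r * spectral_radius A' \<le> spectral_radius A" using r e(2) by (simp add: norm_mult)
  with r(3) have "r * spectral_radius A' < r * 1" by linarith
  then have "spectral_radius A' < 1" by (simp only: mult_less_cancel_left_pos[OF r(1)])
  then obtain c where c: "\<And>k. norm_bound (A' ^\<^sub>m k) c"
    using spectral_radius_jnf_norm_bound_less_1_upper_triangular[OF A'] by auto
  have bound: "cmod ((A ^\<^sub>m k) $$ (i, j)) \<le> c * r ^ k" for k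
  proof -
    have A'k: "A' ^\<^sub>m k \<in> carrier_mat n n" using A' by (rule pow_carrier_mat)
    have "cmod ((A' ^\<^sub>m k) $$ (i, j)) \<le> c"
      using c[of k] carrier_matD[OF A'] ij by (auto simp: norm_bound_def)
    moreover have "(A ^\<^sub>m k) $$ (i, j) = complex_of_real r ^ k * (A' ^\<^sub>m k) $$ (i, j)"
      using A_eq pow_mat_smult[OF A', of "complex_of_real r" k] carrier_matD[OF A'k] ij by simp
    ultimately show ?thesis using r by (simp add: norm_mult norm_power mult.commute mult_right_mono)
  qed
  have lim: "(\<lambda>k. c * r ^ k) \<longlonglongrightarrow> 0"
    using tendsto_mult_right_zero[OF LIMSEQ_power_zero[of r], of c] r by simp
  have "(\<lambda>k. cmod ((A ^\<^sub>m k) $$ (i, j))) \<longlonglongrightarrow> 0"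
    by (rule tendsto_sandwich[OF _ _ tendsto_const lim]) (simp_all add: bound)
  then show ?thesis by (rule tendsto_norm_zero_cancel)
qed

lemma vec_converges_componentwise:
  assumes x: "\<And>n. x n - l \<in> carrier_vec N"
    and lim: "\<And>i. i < N \<Longrightarrow> (\<lambda>n. (x n - l) $ i) \<longlonglongrightarrow> 0"
  shows "vec_converges x l"
proof -
  have "(\<lambda>n. sqrt (\<Sum>i = 0..<N. (x n - l) $ i * (x n - l) $ i)) \<longlonglongrightarrow> sqrt (\<Sum>i = 0..<N. 0 * 0)"
    by (intro tendsto_intros lim) auto
  moreover have "dim_vec (x n - l) = N" for n using carrier_vecD[OF x[of n]] .
  ultimately show ?thesis unfolding vec_converges_def euclidean_norm_def scalar_prod_def by simp
qed

lemma linear_iteration_converges: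
  assumes S: "S \<in> carrier_mat N N" and sr: "spectral_radius (complex_mat S) < 1"
    and l: "l \<in> carrier_vec N" and x: "\<And>n. x n \<in> carrier_vec N"
    and step: "\<And>n. l - x (Suc n) = S *\<^sub>v (l - x n)"
  shows "vec_converges x l"
proof (rule vec_converges_componentwise)
  show "x n - l \<in> carrier_vec N" for n using l x by simp
  fix i assume i: "i < N"
  have error: "l - x n = (S ^\<^sub>m n) *\<^sub>v (l - x 0)" for n
  proof (induction n)
    case 0
    have "l - x 0 \<in> carrier_vec N" using l x by simp
    then show ?case using S by simp
  next
    case (Suc n)
    have "l - x 0 \<in> carrier_vec N" using l x by simp
    moreover have "S * S ^\<^sub>m n = S ^\<^sub>m n * S"
      by (induction n) (use S in \<open>simp_all flip: assoc_mult_mat[OF S pow_carrier_mat[OF S] S]\<close>)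
    ultimately show ?case
      using step[of n] Suc assoc_mult_mat_vec[OF S pow_carrier_mat[OF S, of n], of "l - x 0"] by simp
  qed
  have entry: "(\<lambda>n. (S ^\<^sub>m n) $$ (i, j)) \<longlonglongrightarrow> 0" if "j < N" for j
  proof -
    have "(complex_mat S ^\<^sub>m n) $$ (i, j) = complex_of_real ((S ^\<^sub>m n) $$ (i, j))" for n
      using of_real_hom.mat_hom_pow[OF S, of n] pow_carrier_mat[OF S, of n] i that
      by (metis carrier_matD index_map_mat(1))
    then have "(\<lambda>n. complex_of_real ((S ^\<^sub>m n) $$ (i, j))) \<longlonglongrightarrow> complex_of_real 0"
      using pow_mat_entries_tendsto_0[OF _ sr i that] S by simp
    then show ?thesis by (simp only: tendsto_of_real_iff)
  qed
  have "(x n - l) $ i = - (\<Sum>j = 0..<N. (S ^\<^sub>m n) $$ (i, j) * (l - x 0) $ j)" for n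
  proof -
    have "(x n - l) $ i = - (l - x n) $ i" using l x[of n] i by simp
    also have "(l - x n) $ i = (\<Sum>j = 0..<N. (S ^\<^sub>m n) $$ (i, j) * (l - x 0) $ j)"
      using i x[of 0] l carrier_matD[OF pow_carrier_mat[OF S, of n]] unfolding error[of n]
      by (auto simp: scalar_prod_def)
    finally show ?thesis .
  qed
  moreover have "(\<lambda>n. - (\<Sum>j = 0..<N. (S ^\<^sub>m n) $$ (i, j) * (l - x 0) $ j))
      \<longlonglongrightarrow> - (\<Sum>j = 0..<N. 0 * (l - x 0) $ j)"
    by (intro tendsto_intros entry) auto
  ultimately show "(\<lambda>n. (x n - l) $ i) \<longlonglongrightarrow> 0" by simp
qed

section \<open>The deflated preconditioner\<close>

lemma minv_inverse:
  assumes A: "A \<in> carrier_mat n n" "invertible_mat A"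
  shows "minv A \<in> carrier_mat n n" "A * minv A = 1\<^sub>m n" "minv A * A = 1\<^sub>m n"
proof -
  obtain B where AB: "A * B = 1\<^sub>m n" "B * A = 1\<^sub>m (dim_row B)"
    using A unfolding invertible_mat_def inverts_mat_def by auto
  have "dim_col B = n" "dim_row B = n"
    using arg_cong[OF AB(1), of dim_col] arg_cong[OF AB(2), of dim_col] A by simp_all
  then have "A \<in> Units (ring_mat TYPE(real) n n)"
    using A AB by (auto simp: Units_def ring_mat_simps intro!: bexI[of _ B])
  then obtain C where C: "mat_inverse A = Some C"
    using mat_inverse(1)[OF A(1), of n] by (cases "mat_inverse A") auto
  then show "minv A \<in> carrier_mat n n" "A * minv A = 1\<^sub>m n" "minv A * A = 1\<^sub>m n"
    using mat_inverse(2)[OF A(1) C] by (auto simp: minv_def)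
qed

lemma minv_minv:
  assumes A: "A \<in> carrier_mat n n" "invertible_mat A"
  shows "minv (minv A) = A"
proof -
  note inv = minv_inverse[OF A]
  have "invertible_mat (minv A)"
    using A inv unfolding invertible_mat_def inverts_mat_def by auto
  note inv' = minv_inverse[OF inv(1) this]
  have "minv (minv A) = minv (minv A) * (minv A * A)" using inv inv' by simp
  also have "\<dots> = A" using assoc_mult_mat[OF inv'(1) inv(1) A(1)] inv' A by simp
  finally show ?thesis .
qed

lemma det_nonzero_imp_invertible_mat:
  fixes A :: "'a :: field mat"
  assumes A: "A \<in> carrier_mat n n" and "det A \<noteq> 0"
  shows "invertible_mat A"
proof -
  have "A \<in> Units (ring_mat TYPE('a) n ())" using assms by (rule det_non_zero_imp_unit)
  then obtain B where "B \<in> carrier_mat n n" "A * B = 1\<^sub>m n" "B * A = 1\<^sub>m n"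
    by (auto simp: Units_def ring_mat_simps)
  then show ?thesis using A unfolding invertible_mat_def inverts_mat_def by auto
qed

text \<open>A kernel vector of \<open>D\<close> would be an eigenvector of \<open>1 - D\<close> for the eigenvalue 1.\<close>

lemma spectral_radius_less_1_imp_det_nonzero:
  assumes D: "D \<in> carrier_mat N N" and N: "N > 0"
    and sr: "spectral_radius (complex_mat (1\<^sub>m N - D)) < 1"
  shows "det D \<noteq> 0"
proof
  assume "det D = 0"
  then obtain v where v: "v \<in> carrier_vec N" "v \<noteq> 0\<^sub>v N" "D *\<^sub>v v = 0\<^sub>v N"
    using det_0_iff_vec_prod_zero[OF D] by blast
  have E: "1\<^sub>m N - D \<in> carrier_mat N N" using D by simp
  have "(1\<^sub>m N - D) *\<^sub>v v = 1 \<cdot>\<^sub>v v"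
    using v D by (simp add: minus_mult_distrib_mat_vec[of _ N N])
  then have "eigenvector (1\<^sub>m N - D) v 1" using v D by (simp add: eigenvector_def)
  from of_real_hom.eigenvector_hom[OF E this]
  have "1 \<in> spectrum (complex_mat (1\<^sub>m N - D))"
    by (auto simp: spectrum_def eigenvalue_def)
  then have "cmod 1 \<le> spectral_radius (complex_mat (1\<^sub>m N - D))"
    using E by (intro spectral_radius_mem_max(2)[OF _ N] imageI) auto
  with sr show False by simp
qed

text \<open>The error matrix factors through the complementary projection; all spectral statements below
  are about this product.\<close>

lemma deflated_error_matrix:
  assumes K: "minv P * A \<in> carrier_mat N N" and Q: "Q \<in> carrier_mat N N"
  shows "1\<^sub>m N - deflated_matrix N A P Q = (1\<^sub>m N - minv P * A) * (1\<^sub>m N - Q)"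
proof -
  have R: "1\<^sub>m N - Q \<in> carrier_mat N N" using Q by simp
  have "(1\<^sub>m N - minv P * A) * (1\<^sub>m N - Q) = 1\<^sub>m N - Q - minv P * A * (1\<^sub>m N - Q)"
    using minus_mult_distrib_mat[OF one_carrier_mat K R] left_mult_one_mat[OF R] by simp
  also have "\<dots> = 1\<^sub>m N - deflated_matrix N A P Q"
    unfolding deflated_matrix_def using Q mult_carrier_mat[OF K R] by (intro eq_matI) auto
  finally show ?thesis ..
qed

text \<open>The conjugation by \<open>A\<close> in the left projection turns the two terms of the inverse preconditioner into
  those of the deflated matrix, up to the factor \<open>A\<close> inverse on the right.\<close>

lemma deflated_precond_inverse_conv:
  assumes A: "A \<in> carrier_mat N N" "invertible_mat A" and P: "minv P \<in> carrier_mat N N"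
    and Q: "Q \<in> carrier_mat N N"
  shows "deflated_precond_inverse N A P Q = deflated_matrix N A P Q * minv A"
proof -
  note A' = minv_inverse[OF A]
  have R: "1\<^sub>m N - Q \<in> carrier_mat N N" using Q by simp
  have AQ: "A * Q \<in> carrier_mat N N" and QA': "Q * minv A \<in> carrier_mat N N"
    and PA: "minv P * A \<in> carrier_mat N N" and RA': "(1\<^sub>m N - Q) * minv A \<in> carrier_mat N N"
    and L: "A * (Q * minv A) \<in> carrier_mat N N"
    using A A' Q P R by auto
  have left: "left_projection A Q = A * (Q * minv A)"
    unfolding left_projection_def by (rule assoc_mult_mat[OF A(1) Q A'(1)])
  have "minv A * (A * (Q * minv A)) = Q * minv A"
    using assoc_mult_mat[OF A'(1) A(1) QA'] A'(3) left_mult_one_mat[OF QA'] by simp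
  moreover have "A * ((1\<^sub>m N - Q) * minv A) = 1\<^sub>m N - A * (Q * minv A)"
    using minus_mult_distrib_mat[OF one_carrier_mat Q A'(1)]
      mult_minus_distrib_mat[OF A(1) A'(1) QA'] A' by simp
  then have "minv P * (1\<^sub>m N - A * (Q * minv A)) = minv P * A * (1\<^sub>m N - Q) * minv A"
    using assoc_mult_mat[OF P A(1) RA'] assoc_mult_mat[OF PA R A'(1)] by simp
  ultimately show ?thesis
    unfolding deflated_precond_inverse_def left deflated_matrix_def
    using add_mult_distrib_mat[OF Q mult_carrier_mat[OF PA R] A'(1)] by simp
qed

theorem theorem1:
  fixes N M :: nat
    and A P Q\<^sub>R :: "real mat"
    and b xinf :: "real vec"
    and Z :: "real vec set"
    and troublesome :: "complex set"
  assumes A: "A \<in> carrier_mat N N" "invertible_mat A"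
    and P: "P \<in> carrier_mat N N" "invertible_mat P"
    and b: "b \<in> carrier_vec N"
    and xinf: "xinf \<in> carrier_vec N" "A *\<^sub>v xinf = b"
    and Z: "vec_subspace N Z" "vec_subspace_dim N Z = M" "M < N"
    and Z_invariant: "\<And>z. z \<in> Z \<Longrightarrow> (minv P * A) *\<^sub>v z \<in> Z"
    and troublesome: "troublesome \<subseteq> spectrum (complex_mat (1\<^sub>m N - minv P * A))"
    and large_troublesome:
      "\<And>e. e \<in> spectrum (complex_mat (1\<^sub>m N - minv P * A)) \<Longrightarrow> cmod e \<ge> 1 \<Longrightarrow> e \<in> troublesome"
    and Z_contains:
      "\<And>e v. e \<in> troublesome \<Longrightarrow>
         generalized_eigenvector (complex_mat (1\<^sub>m N - minv P * A)) v e \<Longrightarrow>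
         v \<in> complexification Z"
    and Q\<^sub>R: "projection_onto N Z Q\<^sub>R"
  shows "eigvals (1\<^sub>m N - deflated_matrix N A P Q\<^sub>R) =
           replicate_mset M 0 + non_deflated_eigvals N (1\<^sub>m N - minv P * A) Z
       \<and> (\<forall>x. (\<forall>n. x n \<in> carrier_vec N) \<and>
              (\<forall>n. x (Suc n) = x n + deflated_matrix N A P Q\<^sub>R *\<^sub>v (xinf - x n))
            \<longrightarrow> vec_converges x xinf
              \<and> (\<forall>n. xinf - x (Suc n) = (1\<^sub>m N - deflated_matrix N A P Q\<^sub>R) *\<^sub>v (xinf - x n)))
       \<and> invertible_mat (deflated_precond_inverse N A P Q\<^sub>R)
       \<and> (\<forall>x. (\<forall>n. x n \<in> carrier_vec N) \<longrightarrow>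
            (fixed_point_iteration A (deflated_precond N A P Q\<^sub>R) b x \<longleftrightarrow>
             (\<forall>n. x (Suc n) = x n + deflated_matrix N A P Q\<^sub>R *\<^sub>v (xinf - x n))))
       \<and> spectral_radius (complex_mat (1\<^sub>m N - deflated_matrix N A P Q\<^sub>R)) =
           Max (cmod ` set_mset (non_deflated_eigvals N (1\<^sub>m N - minv P * A) Z))
       \<and> Max (cmod ` set_mset (non_deflated_eigvals N (1\<^sub>m N - minv P * A) Z)) < 1"
proof -
  define K T where "K = minv P * A" and "T = 1\<^sub>m N - K"
  define D where "D = deflated_matrix N A P Q\<^sub>R"
  let ?nd = "non_deflated_eigvals N T Z"
  note A' = minv_inverse[OF A] and P' = minv_inverse[OF P]
  have Q: "Q\<^sub>R \<in> carrier_mat N N" using Q\<^sub>R by (simp add: projection_onto_def)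
  have K: "K \<in> carrier_mat N N" using A P' by (simp add: K_def)
  have T: "T \<in> carrier_mat N N" using K by (simp add: T_def)
  have D: "D \<in> carrier_mat N N"
    unfolding D_def deflated_matrix_def using K Q by (auto simp flip: K_def)
  have E: "1\<^sub>m N - D \<in> carrier_mat N N" using D by simp
  have Z_carrier: "Z \<subseteq> carrier_vec N" using Q\<^sub>R Q by (auto simp: projection_onto_def)
  have T_inv: "T *\<^sub>v z \<in> Z" if "z \<in> Z" for z
  proof -
    have z: "z \<in> carrier_vec N" using that Z_carrier by blast
    have "Q\<^sub>R *\<^sub>v z = z" "Q\<^sub>R *\<^sub>v (K *\<^sub>v z) = K *\<^sub>v z"
      using projection_onto_fixes[OF Q\<^sub>R] Z_invariant that by (auto simp: K_def)
    moreover have Tz: "T *\<^sub>v z = z - K *\<^sub>v z"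
      unfolding T_def using minus_mult_distrib_mat_vec[OF one_carrier_mat K z] z by simp
    ultimately have "Q\<^sub>R *\<^sub>v (T *\<^sub>v z) = T *\<^sub>v z"
      using mult_minus_distrib_mat_vec[OF Q z, of "K *\<^sub>v z"] K z by simp
    moreover have "T *\<^sub>v z \<in> carrier_vec N" using T z by simp
    ultimately show ?thesis using Q\<^sub>R unfolding projection_onto_def by (metis imageI)
  qed
  have D_eq: "1\<^sub>m N - D = T * (1\<^sub>m N - Q\<^sub>R)"
    unfolding D_def T_def K_def by (rule deflated_error_matrix[OF K[unfolded K_def] Q])
  have eig: "eigvals (1\<^sub>m N - D) = replicate_mset M 0 + ?nd"
    using eigvals_deflated[OF Z(1) Q\<^sub>R T T_inv] Z(2) by (simp add: D_eq)
  have nd_small: "cmod e < 1" if e: "e \<in># ?nd" for e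
  proof (rule ccontr)
    assume "\<not> cmod e < 1"
    then have large: "cmod e \<ge> 1" by simp
    have "e \<in># eigvals T" using e unfolding non_deflated_eigvals_def by (rule in_diffD)
    then have "e \<in> spectrum (complex_mat T)" using set_mset_eigvals[OF T] by simp
    then have "e \<in> troublesome" using large_troublesome large by (simp add: T_def K_def)
    then have "\<And>v. generalized_eigenvector (complex_mat T) v e \<Longrightarrow> v \<in> complexification Z"
      using Z_contains by (simp add: T_def K_def)
    moreover have "e \<noteq> 0" using large by auto
    ultimately show False using non_deflated_eigval_not_absorbed[OF Z(1) Q\<^sub>R T T_inv] e by blast
  qed
  \<comment> \<open>\<open>M < N\<close> leaves at least one non-deflated eigenvalue, so the maximum is taken over a nonempty set
    and the additional zeros cannot exceed it.\<close>
  have "M + size ?nd = N" using size_eigvals[OF E] by (simp add: eig)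
  then have nd_ne: "set_mset ?nd \<noteq> {}" using Z(3) by auto
  have Max_nd: "Max (cmod ` set_mset ?nd) < 1" using nd_small nd_ne by simp
  have sr: "spectral_radius (complex_mat (1\<^sub>m N - D)) = Max (cmod ` set_mset ?nd)"
  proof -
    have "0 \<le> Max (cmod ` set_mset ?nd)"
      using nd_ne by (auto simp: Max_ge_iff)
    then have "Max (insert 0 (cmod ` set_mset ?nd)) = Max (cmod ` set_mset ?nd)"
      using nd_ne by simp
    then show ?thesis
      by (cases "M = 0") (simp_all add: spectral_radius_def eig flip: set_mset_eigvals[OF E])
  qed
  have sr1: "spectral_radius (complex_mat (1\<^sub>m N - D)) < 1" using sr Max_nd by simp
  have conv: "vec_converges x xinf \<and> (\<forall>n. xinf - x (Suc n) = (1\<^sub>m N - D) *\<^sub>v (xinf - x n))"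
    if x: "\<And>n. x n \<in> carrier_vec N" and step: "\<And>n. x (Suc n) = x n + D *\<^sub>v (xinf - x n)" for x
  proof -
    have error: "xinf - x (Suc n) = (1\<^sub>m N - D) *\<^sub>v (xinf - x n)" for n
    proof -
      have y: "xinf - x n \<in> carrier_vec N" using x xinf by simp
      then have "D *\<^sub>v (xinf - x n) \<in> carrier_vec N" using D by simp
      then show ?thesis
        using minus_mult_distrib_mat_vec[OF one_carrier_mat D y] carrier_matD[OF D] y x[of n] xinf
        by (subst step) (auto intro!: eq_vecI)
    qed
    moreover have "vec_converges x xinf"
      by (rule linear_iteration_converges[where x = x, OF E sr1 xinf(1) x error])
    ultimately show ?thesis by simp
  qed
  have "det A * det (minv A) = 1" using det_mult[OF A(1) A'(1)] A' by simp
  then have "det (D * minv A) \<noteq> 0"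
    using det_mult[OF D A'(1)] spectral_radius_less_1_imp_det_nonzero[OF D _ sr1] Z(3) by auto
  then have "invertible_mat (D * minv A)"
    using D A' by (intro det_nonzero_imp_invertible_mat[of _ N]) auto
  moreover have pre: "deflated_precond_inverse N A P Q\<^sub>R = D * minv A"
    unfolding D_def by (rule deflated_precond_inverse_conv[OF A P'(1) Q])
  ultimately have inv: "invertible_mat (deflated_precond_inverse N A P Q\<^sub>R)" by simp
  have "minv (deflated_precond N A P Q\<^sub>R) = D * minv A"
    unfolding deflated_precond_def
    using minv_minv[OF _ inv, of N] D A' by (simp add: pre)
  moreover have "(D * minv A) *\<^sub>v (b - A *\<^sub>v y) = D *\<^sub>v (xinf - y)" if y: "y \<in> carrier_vec N" for y
  proof -
    have d: "xinf - y \<in> carrier_vec N" using xinf y by simp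
    have "b - A *\<^sub>v y = A *\<^sub>v (xinf - y)"
      using mult_minus_distrib_mat_vec[OF A(1) xinf(1) y] xinf(2) by simp
    moreover have "minv A *\<^sub>v (A *\<^sub>v (xinf - y)) = xinf - y"
      using assoc_mult_mat_vec[OF A'(1) A(1) d] A'(3) d by simp
    ultimately show ?thesis
      using assoc_mult_mat_vec[OF D A'(1), of "A *\<^sub>v (xinf - y)"] A d by simp
  qed
  ultimately have fp: "fixed_point_iteration A (deflated_precond N A P Q\<^sub>R) b x \<longleftrightarrow>
      (\<forall>n. x (Suc n) = x n + D *\<^sub>v (xinf - x n))" if "\<And>n. x n \<in> carrier_vec N" for x
    using that by (simp add: fixed_point_iteration_def)
  show ?thesis
    unfolding T_def[symmetric, unfolded K_def] D_def[symmetric]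
  proof (intro conjI allI impI)
    fix x :: "nat \<Rightarrow> real vec"
    assume x: "(\<forall>n. x n \<in> carrier_vec N) \<and> (\<forall>n. x (Suc n) = x n + D *\<^sub>v (xinf - x n))"
    then have "vec_converges x xinf \<and> (\<forall>n. xinf - x (Suc n) = (1\<^sub>m N - D) *\<^sub>v (xinf - x n))"
      by (intro conv) simp_all
    then show "vec_converges x xinf"
      and "xinf - x (Suc n) = (1\<^sub>m N - D) *\<^sub>v (xinf - x n)" for n
      by simp_all
  next
    fix x :: "nat \<Rightarrow> real vec"
    assume "\<forall>n. x n \<in> carrier_vec N"
    then show "fixed_point_iteration A (deflated_precond N A P Q\<^sub>R) b x \<longleftrightarrow>
        (\<forall>n. x (Suc n) = x n + D *\<^sub>v (xinf - x n))"
      by (intro fp) simp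
  qed (use eig inv sr Max_nd in simp_all)
qed

end
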